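(* The following soundness inclusions hold, where each system is identified with its set of theorems: \begin{itemize} \item ${\bf E^\Delta}={\bf EZ^\Delta}\subseteq \text{Th}_\Delta(\mathbb{F}_{\text{all}})\subseteq \text{Th}_\Delta(\mathbb{F}_z)$; \item ${\bf M^\Delta}\subseteq \text{Th}_\Delta(\mathbb{F}_m)$; \item ${\bf ECZ^\Delta}\subseteq \text{Th}_\Delta(\mathbb{F}_{cz})$; \item ${\bf EN^\Delta}={\bf ENZ^\Delta}\subseteq \text{Th}_\Delta(\mathbb{F}_n)\subseteq \text{Th}_\Delta(\mathbb{F}_{nz})$; \item ${\bf R^\Delta}\subseteq \text{Th}_\Delta(\mathbb{F}_{mc})$; \item ${\bf EMN^\Delta}\subseteq \text{Th}_\Delta(\mathbb{F}_{mn})$; \item ${\bf ECNZ^\Delta}\subseteq \text{Th}_\Delta(\mathbb{F}_{cnz})$; \item ${\bf K^\Delta}\subseteq \text{Th}_\Delta(\mathbb{F}_{mcn})$. \end{itemize}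
   Context: Fix a nonempty set $\mathbf{P}$ of propositional variables. The language $\mathcal{L}(\Delta)$ is given by $\varphi::=p\in\mathbf{P}\mid\neg\varphi\mid\varphi\land\varphi\mid\Delta\varphi$; $\vee,\to,\leftrightarrow,\top$ are the usual abbreviations. A neighborhood frame is a pair $\langle S,N\rangle$ with $S$ a nonempty set and $N:S\to\mathcal{P}(\mathcal{P}(S))$; a neighborhood model $\mathcal{M}=\langle S,N,V\rangle$ adds a valuation $V$ assigning a set $V(p)\subseteq S$ to each $p\in\mathbf{P}$. Truth: $\mathcal{M},s\vDash p$ iff $s\in V(p)$; Boolean clauses as usual; $\mathcal{M},s\vDash\Delta\varphi$ iff $\varphi^{\mathcal{M}}\in N(s)$ or $S\setminus\varphi^{\mathcal{M}}\in N(s)$, where $\varphi^{\mathcal{M}}=\{s\in S\mid\mathcal{M},s\vDash\varphi\}$. A formula is valid on a class $\mathbb{K}$ of frames if it is true at every state of every model based on a frame in $\mathbb{K}$; $\text{Th}_\Delta(\mathbb{K})$ is the set of $\mathcal{L}(\Delta)$-formulas valid on $\mathbb{K}$. Frame properties (required for every $s\in S$): $(m)$: $X\in N(s)$ and $X\subseteq Y\subseteq S$ imply $Y\in N(s)$; $(c)$: $X,Y\in N(s)$ implies $X\cap Y\in N(s)$; $(n)$: $S\in N(s)$; $(z)$: $X\in N(s)$ implies $S\setminus X\in N(s)$. $\mathbb{F}_{\text{all}}$ is the class of all neighborhood frames, and e.g. $\mathbb{F}_{mc}$ is the class of frames with properties $(m)$ and $(c)$; similarly for the other subscripts. Axiom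 schemas: TAUT: all instances of propositional tautologies; $\Delta\text{Equ}$: $\Delta\varphi\leftrightarrow\Delta\neg\varphi$; $\Delta\text{M}$: $\Delta\varphi\to\Delta(\varphi\vee\psi)\vee\Delta(\neg\varphi\vee\chi)$; $\Delta\text{C}$: $\Delta\varphi\land\Delta\psi\to\Delta(\varphi\land\psi)$; $\Delta\text{N}$: $\Delta\top$. Rules: MP (from $\varphi$ and $\varphi\to\psi$ infer $\psi$); $\text{RE}\Delta$ (from $\varphi\leftrightarrow\psi$ infer $\Delta\varphi\leftrightarrow\Delta\psi$). Systems: ${\bf E^\Delta}$ and ${\bf EZ^\Delta}$ are two names for the system $\text{TAUT}+\Delta\text{Equ}+\text{MP}+\text{RE}\Delta$; ${\bf M^\Delta}={\bf E^\Delta}+\Delta\text{M}$; ${\bf ECZ^\Delta}={\bf E^\Delta}+\Delta\text{C}$; ${\bf EN^\Delta}$ and ${\bf ENZ^\Delta}$ are two names for ${\bf E^\Delta}+\Delta\text{N}$; ${\bf R^\Delta}={\bf M^\Delta}+\Delta\text{C}$; ${\bf EMN^\Delta}={\bf M^\Delta}+\Delta\text{N}$; ${\bf ECNZ^\Delta}={\bf ECZ^\Delta}+\Delta\text{N}$; ${\bf K^\Delta}={\bf R^\Delta}+\Delta\text{N}$. *)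

theory Defs
  imports Main
begin

datatype 'p fm =
    Atom 'p
  | Neg "'p fm" ("\<^bold>\<not> _" [80] 80)
  | Conj "'p fm" "'p fm" (infixr "\<^bold>\<and>" 75)
  | Delta "'p fm" ("\<^bold>\<Delta> _" [80] 80)

abbreviation Disj :: "'p fm \<Rightarrow> 'p fm \<Rightarrow> 'p fm" (infixr "\<^bold>\<or>" 70)
  where "\<phi> \<^bold>\<or> \<psi> \<equiv> \<^bold>\<not> (\<^bold>\<not> \<phi> \<^bold>\<and> \<^bold>\<not> \<psi>)"

abbreviation Imp :: "'p fm \<Rightarrow> 'p fm \<Rightarrow> 'p fm" (infixr "\<^bold>\<rightarrow>" 65)
  where "\<phi> \<^bold>\<rightarrow> \<psi> \<equiv> \<^bold>\<not> \<phi> \<^bold>\<or> \<psi>"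

abbreviation Iff :: "'p fm \<Rightarrow> 'p fm \<Rightarrow> 'p fm" (infixr "\<^bold>\<leftrightarrow>" 60)
  where "\<phi> \<^bold>\<leftrightarrow> \<psi> \<equiv> (\<phi> \<^bold>\<rightarrow> \<psi>) \<^bold>\<and> (\<psi> \<^bold>\<rightarrow> \<phi>)"

(* The language has no nullary connective, so verum is built from some fixed
   variable; undefined serves as that otherwise arbitrary element of 'p. *)
abbreviation Verum :: "'p fm" ("\<^bold>\<top>")
  where "\<^bold>\<top> \<equiv> Atom undefined \<^bold>\<or> \<^bold>\<not> Atom undefined"

record 'w frame =
  states :: "'w set"
  nbhd :: "'w \<Rightarrow> 'w set set"

(* Values of nbhd outside the set of states are irrelevant and left unconstrained. *)
definition nbhd_frame :: "'w frame \<Rightarrow> bool" where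
  "nbhd_frame F \<longleftrightarrow> states F \<noteq> {} \<and> (\<forall>s\<in>states F. nbhd F s \<subseteq> Pow (states F))"

definition valuation :: "'w frame \<Rightarrow> ('p \<Rightarrow> 'w set) \<Rightarrow> bool" where
  "valuation F V \<longleftrightarrow> (\<forall>p. V p \<subseteq> states F)"

primrec sat :: "'w frame \<Rightarrow> ('p \<Rightarrow> 'w set) \<Rightarrow> 'p fm \<Rightarrow> 'w \<Rightarrow> bool" where
  "sat F V (Atom p) = (\<lambda>s. s \<in> V p)"
| "sat F V (\<^bold>\<not> \<phi>) = (\<lambda>s. \<not> sat F V \<phi> s)"
| "sat F V (\<phi> \<^bold>\<and> \<psi>) = (\<lambda>s. sat F V \<phi> s \<and> sat F V \<psi> s)"
| "sat F V (\<^bold>\<Delta> \<phi>) = (\<lambda>s. {t \<in> states F. sat F V \<phi> t} \<in> nbhd F s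
      \<or> states F - {t \<in> states F. sat F V \<phi> t} \<in> nbhd F s)"

definition valid_on :: "'w frame set \<Rightarrow> 'p fm \<Rightarrow> bool" where
  "valid_on K \<phi> \<longleftrightarrow> (\<forall>F\<in>K. \<forall>V. valuation F V \<longrightarrow> (\<forall>s\<in>states F. sat F V \<phi> s))"

(* Frames live in a type 'w of potential states. Facts proved for an arbitrary 'w hold
   for frames of every size, as each nonempty set is the carrier of a frame over some type. *)
definition Th :: "'w frame set \<Rightarrow> 'p fm set" where
  "Th K = {\<phi>. valid_on K \<phi>}"

definition prop_m :: "'w frame \<Rightarrow> bool" where
  "prop_m F \<longleftrightarrow> (\<forall>s\<in>states F. \<forall>X Y.
     X \<in> nbhd F s \<longrightarrow> X \<subseteq> Y \<longrightarrow> Y \<subseteq> states F \<longrightarrow> Y \<in> nbhd F s)"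

definition prop_c :: "'w frame \<Rightarrow> bool" where
  "prop_c F \<longleftrightarrow> (\<forall>s\<in>states F. \<forall>X Y. X \<in> nbhd F s \<longrightarrow> Y \<in> nbhd F s \<longrightarrow> X \<inter> Y \<in> nbhd F s)"

definition prop_n :: "'w frame \<Rightarrow> bool" where
  "prop_n F \<longleftrightarrow> (\<forall>s\<in>states F. states F \<in> nbhd F s)"

definition prop_z :: "'w frame \<Rightarrow> bool" where
  "prop_z F \<longleftrightarrow> (\<forall>s\<in>states F. \<forall>X. X \<in> nbhd F s \<longrightarrow> states F - X \<in> nbhd F s)"

definition F_all :: "'w frame set" where "F_all = {F. nbhd_frame F}"
definition F_z :: "'w frame set" where "F_z = {F \<in> F_all. prop_z F}"
definition F_m :: "'w frame set" where "F_m = {F \<in> F_all. prop_m F}"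
definition F_cz :: "'w frame set" where "F_cz = {F \<in> F_all. prop_c F \<and> prop_z F}"
definition F_n :: "'w frame set" where "F_n = {F \<in> F_all. prop_n F}"
definition F_nz :: "'w frame set" where "F_nz = {F \<in> F_all. prop_n F \<and> prop_z F}"
definition F_mc :: "'w frame set" where "F_mc = {F \<in> F_all. prop_m F \<and> prop_c F}"
definition F_mn :: "'w frame set" where "F_mn = {F \<in> F_all. prop_m F \<and> prop_n F}"
definition F_cnz :: "'w frame set" where "F_cnz = {F \<in> F_all. prop_c F \<and> prop_n F \<and> prop_z F}"
definition F_mcn :: "'w frame set" where "F_mcn = {F \<in> F_all. prop_m F \<and> prop_c F \<and> prop_n F}"

(* Propositional formulas over countably many letters, independent of 'p:
   tautologies in many letters must be available for instantiation even if 'p is finite. *)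
datatype pl = Letter nat | PNeg pl | PConj pl pl

primrec pl_true :: "(nat \<Rightarrow> bool) \<Rightarrow> pl \<Rightarrow> bool" where
  "pl_true v (Letter n) = v n"
| "pl_true v (PNeg \<pi>) = (\<not> pl_true v \<pi>)"
| "pl_true v (PConj \<pi> \<rho>) = (pl_true v \<pi> \<and> pl_true v \<rho>)"

definition tautology :: "pl \<Rightarrow> bool" where
  "tautology \<pi> \<longleftrightarrow> (\<forall>v. pl_true v \<pi>)"

primrec inst :: "(nat \<Rightarrow> 'p fm) \<Rightarrow> pl \<Rightarrow> 'p fm" where
  "inst \<sigma> (Letter n) = \<sigma> n"
| "inst \<sigma> (PNeg \<pi>) = \<^bold>\<not> (inst \<sigma> \<pi>)"
| "inst \<sigma> (PConj \<pi> \<rho>) = inst \<sigma> \<pi> \<^bold>\<and> inst \<sigma> \<rho>"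

definition ax_Taut :: "'p fm set" where
  "ax_Taut = {inst \<sigma> \<pi> | \<sigma> \<pi>. tautology \<pi>}"

definition ax_Equ :: "'p fm set" where
  "ax_Equ = {\<^bold>\<Delta> \<phi> \<^bold>\<leftrightarrow> \<^bold>\<Delta> \<^bold>\<not> \<phi> | \<phi>. True}"

definition ax_M :: "'p fm set" where
  "ax_M = {\<^bold>\<Delta> \<phi> \<^bold>\<rightarrow> \<^bold>\<Delta> (\<phi> \<^bold>\<or> \<psi>) \<^bold>\<or> \<^bold>\<Delta> (\<^bold>\<not> \<phi> \<^bold>\<or> \<chi>) | \<phi> \<psi> \<chi>. True}"

definition ax_C :: "'p fm set" where
  "ax_C = {\<^bold>\<Delta> \<phi> \<^bold>\<and> \<^bold>\<Delta> \<psi> \<^bold>\<rightarrow> \<^bold>\<Delta> (\<phi> \<^bold>\<and> \<psi>) | \<phi> \<psi>. True}"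

definition ax_N :: "'p fm set" where
  "ax_N = {\<^bold>\<Delta> \<^bold>\<top>}"

inductive_set theorems :: "'p fm set \<Rightarrow> 'p fm set" for Ax :: "'p fm set" where
  Ax: "\<phi> \<in> Ax \<Longrightarrow> \<phi> \<in> theorems Ax"
| MP: "\<phi> \<in> theorems Ax \<Longrightarrow> \<phi> \<^bold>\<rightarrow> \<psi> \<in> theorems Ax \<Longrightarrow> \<psi> \<in> theorems Ax"
| RE: "\<phi> \<^bold>\<leftrightarrow> \<psi> \<in> theorems Ax \<Longrightarrow> \<^bold>\<Delta> \<phi> \<^bold>\<leftrightarrow> \<^bold>\<Delta> \<psi> \<in> theorems Ax"

definition sys_E :: "'p fm set" where "sys_E = theorems (ax_Taut \<union> ax_Equ)"
definition sys_EZ :: "'p fm set" where "sys_EZ = theorems (ax_Taut \<union> ax_Equ)"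
definition sys_M :: "'p fm set" where "sys_M = theorems (ax_Taut \<union> ax_Equ \<union> ax_M)"
definition sys_ECZ :: "'p fm set" where "sys_ECZ = theorems (ax_Taut \<union> ax_Equ \<union> ax_C)"
definition sys_EN :: "'p fm set" where "sys_EN = theorems (ax_Taut \<union> ax_Equ \<union> ax_N)"
definition sys_ENZ :: "'p fm set" where "sys_ENZ = theorems (ax_Taut \<union> ax_Equ \<union> ax_N)"
definition sys_R :: "'p fm set" where "sys_R = theorems (ax_Taut \<union> ax_Equ \<union> ax_M \<union> ax_C)"
definition sys_EMN :: "'p fm set" where "sys_EMN = theorems (ax_Taut \<union> ax_Equ \<union> ax_M \<union> ax_N)"
definition sys_ECNZ :: "'p fm set" where "sys_ECNZ = theorems (ax_Taut \<union> ax_Equ \<union> ax_C \<union> ax_N)"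
definition sys_K :: "'p fm set" where "sys_K = theorems (ax_Taut \<union> ax_Equ \<union> ax_M \<union> ax_C \<union> ax_N)"

end

theory Submission
  imports Defs
begin

text \<open>
  Soundness is an induction on derivations. The two rules preserve validity on any class of
  frames, whatever its properties: modus ponens pointwise, and replacement of equivalents because
  a valid equivalence makes the two truth sets equal, while the truth of \<open>\<^bold>\<Delta> \<phi>\<close> depends on \<open>\<phi>\<close>
  only through its truth set (\<open>theorems_sound\<close>). Hence only axioms have to be examined.

  Write \<open>X\<close> for the truth set of \<open>\<phi>\<close> in a frame on \<open>S\<close>. Since \<open>\<^bold>\<Delta> \<phi>\<close> says that \<open>X\<close> or \<open>S - X\<close> is a
  neighborhood, it is insensitive to negating \<open>\<phi>\<close>, which is the axiom \<open>ax_Equ\<close>. Under monotonicity,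
  \<open>X\<close> or \<open>S - X\<close> can be enlarged, giving one of the two disjuncts of \<open>ax_M\<close>. For \<open>ax_C\<close>, closure
  under intersections deals with two positive witnesses. A negative witness can be handled in two
  ways: closure under complements turns it into a positive one, while under monotonicity \<open>S - X\<close>
  settles the conjunction by itself, the complement of the smaller truth set being larger.
  Finally, \<open>\<^bold>\<top>\<close> has truth set \<open>S\<close>, which yields \<open>ax_N\<close>.

  The inclusions between logics of frame classes hold because a smaller class validates more formulas.
\<close>

definition truth_set :: "'w frame \<Rightarrow> ('p \<Rightarrow> 'w set) \<Rightarrow> 'p fm \<Rightarrow> 'w set" where
  "truth_set F V \<phi> = {t \<in> states F. sat F V \<phi> t}"

lemma truth_set_subset: "truth_set F V \<phi> \<subseteq> states F"
  by (auto simp: truth_set_def)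

lemma truth_set_Neg: "truth_set F V (\<^bold>\<not> \<phi>) = states F - truth_set F V \<phi>"
  by (auto simp: truth_set_def)

lemma truth_set_Conj: "truth_set F V (\<phi> \<^bold>\<and> \<psi>) = truth_set F V \<phi> \<inter> truth_set F V \<psi>"
  by (auto simp: truth_set_def)

lemma truth_set_Disj: "truth_set F V (\<phi> \<^bold>\<or> \<psi>) = truth_set F V \<phi> \<union> truth_set F V \<psi>"
  by (auto simp: truth_set_def)

lemma truth_set_Verum: "truth_set F V \<^bold>\<top> = states F"
  by (auto simp: truth_set_def)

lemma sat_Delta:
  "sat F V (\<^bold>\<Delta> \<phi>) s \<longleftrightarrow>
     truth_set F V \<phi> \<in> nbhd F s \<or> states F - truth_set F V \<phi> \<in> nbhd F s"
  by (simp add: truth_set_def)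

lemma Th_iff:
  "\<phi> \<in> Th K \<longleftrightarrow> (\<forall>F\<in>K. \<forall>V. valuation F V \<longrightarrow> (\<forall>s\<in>states F. sat F V \<phi> s))"
  by (simp add: Th_def valid_on_def)

lemma ThI:
  assumes "\<And>F V s. F \<in> K \<Longrightarrow> valuation F V \<Longrightarrow> s \<in> states F \<Longrightarrow> sat F V \<phi> s"
  shows "\<phi> \<in> Th K"
  using assms by (auto simp: Th_iff)

lemma Th_antimono: "K \<subseteq> L \<Longrightarrow> Th L \<subseteq> Th K"
  unfolding Th_def valid_on_def by blast

text \<open>This reduces soundness of a system to validity of its axioms. The step for replacement needs
  validity of the premise at every state, since \<open>\<^bold>\<Delta>\<close> at one state inspects the whole truth set.\<close>

lemma theorems_sound:
  fixes Ax :: "'p fm set" and K :: "'w frame set"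
  assumes "Ax \<subseteq> Th K"
  shows "theorems Ax \<subseteq> Th K"
proof
  fix \<phi> assume "\<phi> \<in> theorems Ax"
  then show "\<phi> \<in> Th K"
  proof (induction rule: theorems.induct)
    case (Ax \<phi>)
    with assms show ?case by blast
  next
    case (MP \<phi> \<psi>)
    then show ?case by (auto simp: Th_iff)
  next
    case (RE \<phi> \<psi>)
    show ?case
    proof (rule ThI)
      fix F s and V :: "'p \<Rightarrow> 'w set"
      assume "F \<in> K" "valuation F V" "s \<in> states F"
      with RE.IH have "truth_set F V \<phi> = truth_set F V \<psi>"
        by (auto simp: Th_iff truth_set_def)
      then have "sat F V (\<^bold>\<Delta> \<phi>) s \<longleftrightarrow> sat F V (\<^bold>\<Delta> \<psi>) s"
        by (simp only: sat_Delta)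
      then show "sat F V (\<^bold>\<Delta> \<phi> \<^bold>\<leftrightarrow> \<^bold>\<Delta> \<psi>) s"
        by (simp del: sat.simps(4))
    qed
  qed
qed

text \<open>At a fixed state, an instance of a propositional formula is evaluated by the assignment that
  gives each letter the truth value of its substitute there.\<close>

lemma sat_inst: "sat F V (inst \<sigma> \<pi>) s \<longleftrightarrow> pl_true (\<lambda>n. sat F V (\<sigma> n) s) \<pi>"
  by (induction \<pi>) auto

lemma ax_Taut_valid: "ax_Taut \<subseteq> Th K"
  by (auto simp: ax_Taut_def Th_iff sat_inst tautology_def)

text \<open>The condition defining \<open>\<^bold>\<Delta>\<close> is symmetric in a truth set and its complement.\<close>

lemma sat_Delta_Neg: "sat F V (\<^bold>\<Delta> \<^bold>\<not> \<phi>) s \<longleftrightarrow> sat F V (\<^bold>\<Delta> \<phi>) s"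
  unfolding sat_Delta truth_set_Neg double_diff[OF truth_set_subset subset_refl] by blast

lemma ax_Equ_valid: "ax_Equ \<subseteq> Th K"
  unfolding ax_Equ_def
  by (auto simp: Th_iff sat_Delta_Neg simp del: sat.simps(4))

text \<open>A positive witness for \<open>\<^bold>\<Delta> \<phi>\<close> grows to the truth set of \<open>\<phi> \<^bold>\<or> \<psi>\<close>, a negative one to that of
  \<open>\<^bold>\<not> \<phi> \<^bold>\<or> \<chi>\<close>; which disjunct holds may vary with the state.\<close>

lemma ax_M_valid:
  fixes K :: "'w frame set"
  assumes "\<And>F. F \<in> K \<Longrightarrow> prop_m F"
  shows "(ax_M :: 'p fm set) \<subseteq> Th K"
proof
  fix \<alpha> :: "'p fm" assume "\<alpha> \<in> ax_M"
  then obtain \<phi> \<psi> \<chi> where \<alpha>: "\<alpha> = \<^bold>\<Delta> \<phi> \<^bold>\<rightarrow> \<^bold>\<Delta> (\<phi> \<^bold>\<or> \<psi>) \<^bold>\<or> \<^bold>\<Delta> (\<^bold>\<not> \<phi> \<^bold>\<or> \<chi>)"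
    by (auto simp: ax_M_def)
  show "\<alpha> \<in> Th K"
  proof (rule ThI)
    fix F s and V :: "'p \<Rightarrow> 'w set"
    assume "F \<in> K" and s: "s \<in> states F"
    then have "prop_m F" using assms by blast
    then have m: "truth_set F V \<beta> \<in> nbhd F s"
      if "X \<in> nbhd F s" "X \<subseteq> truth_set F V \<beta>" for X \<beta>
      using that s truth_set_subset[of F V \<beta>] by (simp add: prop_m_def)
    have "sat F V (\<^bold>\<Delta> (\<phi> \<^bold>\<or> \<psi>)) s \<or> sat F V (\<^bold>\<Delta> (\<^bold>\<not> \<phi> \<^bold>\<or> \<chi>)) s" if "sat F V (\<^bold>\<Delta> \<phi>) s"
    proof -
      from that consider "truth_set F V \<phi> \<in> nbhd F s" | "truth_set F V (\<^bold>\<not> \<phi>) \<in> nbhd F s"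
        by (auto simp only: sat_Delta truth_set_Neg)
      then show ?thesis
      proof cases
        case 1
        then have "truth_set F V (\<phi> \<^bold>\<or> \<psi>) \<in> nbhd F s"
          by (rule m) (auto simp only: truth_set_Disj)
        then show ?thesis by (simp only: sat_Delta simp_thms)
      next
        case 2
        then have "truth_set F V (\<^bold>\<not> \<phi> \<^bold>\<or> \<chi>) \<in> nbhd F s"
          by (rule m) (auto simp only: truth_set_Disj)
        then show ?thesis by (simp only: sat_Delta simp_thms)
      qed
    qed
    then show "sat F V \<alpha> s"
      unfolding \<alpha> by (simp del: sat.simps(4))
  qed
qed

text \<open>The two combinations of frame properties that make \<open>ax_C\<close> valid share this reduction to a closure
  property of \<open>\<^bold>\<Delta>\<close> at single states.\<close>

lemma ax_C_validI:
  fixes K :: "'w frame set"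
  assumes "\<And>F (V :: 'p \<Rightarrow> 'w set) s \<phi> \<psi>. F \<in> K \<Longrightarrow> s \<in> states F \<Longrightarrow>
    sat F V (\<^bold>\<Delta> \<phi>) s \<Longrightarrow> sat F V (\<^bold>\<Delta> \<psi>) s \<Longrightarrow> sat F V (\<^bold>\<Delta> (\<phi> \<^bold>\<and> \<psi>)) s"
  shows "(ax_C :: 'p fm set) \<subseteq> Th K"
  using assms unfolding ax_C_def
  by (auto simp: Th_iff simp del: sat.simps(4))

text \<open>Closure under complements turns negative witnesses into positive ones, which are then
  intersected.\<close>

lemma ax_C_valid_cz:
  fixes K :: "'w frame set"
  assumes "\<And>F. F \<in> K \<Longrightarrow> prop_c F \<and> prop_z F"
  shows "(ax_C :: 'p fm set) \<subseteq> Th K"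
proof (rule ax_C_validI)
  fix F s \<phi> \<psi> and V :: "'p \<Rightarrow> 'w set"
  assume "F \<in> K" and s: "s \<in> states F"
    and "sat F V (\<^bold>\<Delta> \<phi>) s" "sat F V (\<^bold>\<Delta> \<psi>) s"
  with assms have c: "prop_c F" and z: "prop_z F" by auto
  have "truth_set F V \<beta> \<in> nbhd F s" if "sat F V (\<^bold>\<Delta> \<beta>) s" for \<beta>
    using that z s double_diff[OF truth_set_subset subset_refl, of F V \<beta>]
    unfolding sat_Delta prop_z_def by metis
  then have "truth_set F V \<phi> \<in> nbhd F s" "truth_set F V \<psi> \<in> nbhd F s"
    using \<open>sat F V (\<^bold>\<Delta> \<phi>) s\<close> \<open>sat F V (\<^bold>\<Delta> \<psi>) s\<close> by blast+
  with c s show "sat F V (\<^bold>\<Delta> (\<phi> \<^bold>\<and> \<psi>)) s"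
    unfolding sat_Delta truth_set_Conj prop_c_def by blast
qed

text \<open>Two positive witnesses are intersected; a single negative one is enlarged to the complement of
  the intersection.\<close>

lemma ax_C_valid_mc:
  fixes K :: "'w frame set"
  assumes "\<And>F. F \<in> K \<Longrightarrow> prop_m F \<and> prop_c F"
  shows "(ax_C :: 'p fm set) \<subseteq> Th K"
proof (rule ax_C_validI)
  fix F s \<phi> \<psi> and V :: "'p \<Rightarrow> 'w set"
  let ?X = "truth_set F V \<phi>" and ?Y = "truth_set F V \<psi>"
  assume "F \<in> K" and s: "s \<in> states F"
    and \<phi>: "sat F V (\<^bold>\<Delta> \<phi>) s" and \<psi>: "sat F V (\<^bold>\<Delta> \<psi>) s"
  with assms have m: "prop_m F" and c: "prop_c F" by auto
  have neg: "states F - ?X \<inter> ?Y \<in> nbhd F s"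
    if "Z \<in> nbhd F s" "Z = states F - ?X \<or> Z = states F - ?Y" for Z
  proof -
    have "Z \<subseteq> states F - ?X \<inter> ?Y" using that(2) by blast
    with m s that(1) show ?thesis unfolding prop_m_def by blast
  qed
  have pos: "?X \<inter> ?Y \<in> nbhd F s" if "?X \<in> nbhd F s" "?Y \<in> nbhd F s"
    using that c s unfolding prop_c_def by blast
  show "sat F V (\<^bold>\<Delta> (\<phi> \<^bold>\<and> \<psi>)) s"
    using \<phi> \<psi> pos neg unfolding sat_Delta truth_set_Conj by blast
qed

lemma ax_N_valid:
  fixes K :: "'w frame set"
  assumes "\<And>F. F \<in> K \<Longrightarrow> prop_n F"
  shows "(ax_N :: 'p fm set) \<subseteq> Th K"
proof
  fix \<alpha> :: "'p fm" assume "\<alpha> \<in> ax_N"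
  then have \<alpha>: "\<alpha> = \<^bold>\<Delta> \<^bold>\<top>" by (simp add: ax_N_def)
  show "\<alpha> \<in> Th K"
    using assms unfolding \<alpha> Th_iff sat_Delta truth_set_Verum prop_n_def by blast
qed

theorem corollary4:
  "((sys_E :: 'p fm set) = sys_EZ
      \<and> (sys_EZ :: 'p fm set) \<subseteq> Th (F_all :: 'w frame set)
      \<and> (Th (F_all :: 'w frame set) :: 'p fm set) \<subseteq> Th (F_z :: 'w frame set))
   \<and> (sys_M :: 'p fm set) \<subseteq> Th (F_m :: 'w frame set)
   \<and> (sys_ECZ :: 'p fm set) \<subseteq> Th (F_cz :: 'w frame set)
   \<and> ((sys_EN :: 'p fm set) = sys_ENZ
      \<and> (sys_ENZ :: 'p fm set) \<subseteq> Th (F_n :: 'w frame set)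
      \<and> (Th (F_n :: 'w frame set) :: 'p fm set) \<subseteq> Th (F_nz :: 'w frame set))
   \<and> (sys_R :: 'p fm set) \<subseteq> Th (F_mc :: 'w frame set)
   \<and> (sys_EMN :: 'p fm set) \<subseteq> Th (F_mn :: 'w frame set)
   \<and> (sys_ECNZ :: 'p fm set) \<subseteq> Th (F_cnz :: 'w frame set)
   \<and> (sys_K :: 'p fm set) \<subseteq> Th (F_mcn :: 'w frame set)"
proof (intro conjI)
  show "(sys_E :: 'p fm set) = sys_EZ"
    by (simp add: sys_E_def sys_EZ_def)
  show "(sys_EZ :: 'p fm set) \<subseteq> Th (F_all :: 'w frame set)"
    unfolding sys_EZ_def
    by (intro theorems_sound Un_least ax_Taut_valid ax_Equ_valid)
  show "(Th (F_all :: 'w frame set) :: 'p fm set) \<subseteq> Th (F_z :: 'w frame set)"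
    by (rule Th_antimono) (auto simp: F_z_def)
  show "(sys_M :: 'p fm set) \<subseteq> Th (F_m :: 'w frame set)"
    unfolding sys_M_def
    by (intro theorems_sound Un_least ax_Taut_valid ax_Equ_valid ax_M_valid)
      (auto simp: F_m_def)
  show "(sys_ECZ :: 'p fm set) \<subseteq> Th (F_cz :: 'w frame set)"
    unfolding sys_ECZ_def
    by (intro theorems_sound Un_least ax_Taut_valid ax_Equ_valid ax_C_valid_cz)
      (auto simp: F_cz_def)
  show "(sys_EN :: 'p fm set) = sys_ENZ"
    by (simp add: sys_EN_def sys_ENZ_def)
  show "(sys_ENZ :: 'p fm set) \<subseteq> Th (F_n :: 'w frame set)"
    unfolding sys_ENZ_def
    by (intro theorems_sound Un_least ax_Taut_valid ax_Equ_valid ax_N_valid)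
      (auto simp: F_n_def)
  show "(Th (F_n :: 'w frame set) :: 'p fm set) \<subseteq> Th (F_nz :: 'w frame set)"
    by (rule Th_antimono) (auto simp: F_n_def F_nz_def)
  show "(sys_R :: 'p fm set) \<subseteq> Th (F_mc :: 'w frame set)"
    unfolding sys_R_def
    by (intro theorems_sound Un_least ax_Taut_valid ax_Equ_valid ax_M_valid ax_C_valid_mc)
      (auto simp: F_mc_def)
  show "(sys_EMN :: 'p fm set) \<subseteq> Th (F_mn :: 'w frame set)"
    unfolding sys_EMN_def
    by (intro theorems_sound Un_least ax_Taut_valid ax_Equ_valid ax_M_valid ax_N_valid)
      (auto simp: F_mn_def)
  show "(sys_ECNZ :: 'p fm set) \<subseteq> Th (F_cnz :: 'w frame set)"
    unfolding sys_ECNZ_def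
    by (intro theorems_sound Un_least ax_Taut_valid ax_Equ_valid ax_C_valid_cz ax_N_valid)
      (auto simp: F_cnz_def)
  show "(sys_K :: 'p fm set) \<subseteq> Th (F_mcn :: 'w frame set)"
    unfolding sys_K_def
    by (intro theorems_sound Un_least ax_Taut_valid ax_Equ_valid ax_M_valid ax_C_valid_mc ax_N_valid)
      (auto simp: F_mcn_def)
qed

end
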